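(* Let $X$ be a separable Tychonoff space whose finest compatible uniformity admits an $\omega^\omega$-base. Then the free topological group $F(X)$ on $X$ admits a local $\omega^\omega$-base.
   Context: The set $\omega^\omega$ of all functions $\omega\to\omega$ carries the pointwise partial order. A filter $\mathcal F$ admits an $\omega^\omega$-base if there is a family $\{F_\alpha:\alpha\in\omega^\omega\}\subseteq\mathcal F$ such that $\alpha\le\beta$ implies $F_\beta\subseteq F_\alpha$ and every element of $\mathcal F$ contains some $F_\alpha$. A uniformity has an $\omega^\omega$-base if its filter of entourages does; a topological group has a local $\omega^\omega$-base if the filter of neighbourhoods of its identity does. The free topological group $F(X)$ on a Tychonoff space $X$ is the topological group which contains $X$ as a topological subspace, is algebraically generated by $X$, and has the property that every continuous map from $X$ to a topological group extends to a continuous homomorphism on $F(X)$. The finest compatible uniformity on $X$ is the finest uniformity inducing the topology of $X$. *)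

theory Defs
  imports "HOL-Analysis.Analysis" "HOL-Algebra.Generated_Groups"
begin

section \<open>Filters with a base indexed by Baire space\<close>

text \<open>
  Functions \<^typ>\<open>nat \<Rightarrow> nat\<close> are compared pointwise by the library's order. A filter living on a
  proper subset \<open>S\<close> of a type is represented by the \<^typ>\<open>'a filter\<close> whose members are the sets
  containing a member of it, so the members need not be subsets of \<open>S\<close>; intersecting
  the \<open>F \<alpha>\<close> with \<open>S\<close> shows that this does not affect the existence of a base.
\<close>

definition has_omega_omega_base :: "'a filter \<Rightarrow> bool" where
  "has_omega_omega_base \<F> \<longleftrightarrow>
     (\<exists>F :: (nat \<Rightarrow> nat) \<Rightarrow> 'a set.
        (\<forall>\<alpha>. eventually (\<lambda>x. x \<in> F \<alpha>) \<F>) \<and>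
        (\<forall>\<alpha> \<beta>. \<alpha> \<le> \<beta> \<longrightarrow> F \<beta> \<subseteq> F \<alpha>) \<and>
        (\<forall>A. eventually (\<lambda>x. x \<in> A) \<F> \<longrightarrow> (\<exists>\<alpha>. F \<alpha> \<subseteq> A)))"

section \<open>Uniformities on a set\<close>

text \<open>
  The conditions of the class \<^class>\<open>uniform_space\<close>, relativised to a carrier set. For \<open>S = {}\<close>
  the only uniformity is \<^term>\<open>bot\<close>.
\<close>

definition uniformity_on_set :: "'a set \<Rightarrow> ('a \<times> 'a) filter \<Rightarrow> bool" where
  "uniformity_on_set S \<U> \<longleftrightarrow>
     \<U> \<le> principal (S \<times> S) \<and>
     (\<forall>E. eventually E \<U> \<longrightarrow> (\<forall>x\<in>S. E (x, x))) \<and>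
     (\<forall>E. eventually E \<U> \<longrightarrow> eventually (\<lambda>(x, y). E (y, x)) \<U>) \<and>
     (\<forall>E. eventually E \<U> \<longrightarrow>
        (\<exists>D. eventually D \<U> \<and> (\<forall>x y z. D (x, y) \<longrightarrow> D (y, z) \<longrightarrow> E (x, z))))"

definition compatible_uniformity :: "'a topology \<Rightarrow> ('a \<times> 'a) filter \<Rightarrow> bool" where
  "compatible_uniformity X \<U> \<longleftrightarrow>
     uniformity_on_set (topspace X) \<U> \<and>
     (\<forall>W. openin X W \<longleftrightarrow>
        W \<subseteq> topspace X \<and> (\<forall>x\<in>W. eventually (\<lambda>(x', y). x' = x \<longrightarrow> y \<in> W) \<U>))"

text \<open>A finer uniformity has more entourages, hence is smaller in the library's order of filters.\<close>

definition finest_compatible_uniformity :: "'a topology \<Rightarrow> ('a \<times> 'a) filter \<Rightarrow> bool" where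
  "finest_compatible_uniformity X \<U> \<longleftrightarrow>
     compatible_uniformity X \<U> \<and> (\<forall>\<V>. compatible_uniformity X \<V> \<longrightarrow> \<U> \<le> \<V>)"

section \<open>Topological groups\<close>

text \<open>No separation axiom is assumed.\<close>

locale topological_group = group G for G (structure) and T :: "'a topology" +
  assumes topspace_eq: "topspace T = carrier G"
    and continuous_mult: "continuous_map (prod_topology T T) T (\<lambda>(x, y). x \<otimes> y)"
    and continuous_inv: "continuous_map T T (\<lambda>x. inv x)"

definition has_local_omega_omega_base :: "('g, 'm) monoid_scheme \<Rightarrow> 'g topology \<Rightarrow> bool" where
  "has_local_omega_omega_base G T \<longleftrightarrow> has_omega_omega_base (nhdsin T \<one>\<^bsub>G\<^esub>)"

text \<open>
  \<open>(G, T)\<close> is a free topological group on \<open>X\<close> with \<open>i\<close> as the inclusion of the generators.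
  HOL cannot quantify over groups on all types, so the target groups \<open>H\<close> range over those whose
  carrier is a set of words in the letters \<open>(x, True)\<close> and \<open>(x, False)\<close>, standing for \<open>x\<close> and
  its inverse. Up to isomorphism, every group generated by an image of \<open>X\<close> occurs
  among them, so this is no restriction: see \<open>free_topological_group_extension\<close> below.
\<close>

definition free_topological_group ::
    "'a topology \<Rightarrow> ('g, 'm) monoid_scheme \<Rightarrow> 'g topology \<Rightarrow> ('a \<Rightarrow> 'g) \<Rightarrow> bool" where
  "free_topological_group X G T i \<longleftrightarrow>
     topological_group G T \<and>
     embedding_map X T i \<and>
     generate G (i ` topspace X) = carrier G \<and>
     (\<forall>(H :: ('a \<times> bool) list monoid) TH f.
        topological_group H TH \<and> continuous_map X TH f \<longrightarrow>
        (\<exists>h \<in> hom G H. continuous_map T TH h \<and> (\<forall>x \<in> topspace X. h (i x) = f x)))"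

definition word_value :: "('h, 'm) monoid_scheme \<Rightarrow> ('a \<Rightarrow> 'h) \<Rightarrow> ('a \<times> bool) list \<Rightarrow> 'h" where
  "word_value H f w =
     foldr (\<lambda>(x, b) y. (if b then f x else inv\<^bsub>H\<^esub> (f x)) \<otimes>\<^bsub>H\<^esub> y) w \<one>\<^bsub>H\<^esub>"

lemma (in group) word_value_closed:
  assumes "f ` S \<subseteq> carrier G" "fst ` set w \<subseteq> S"
  shows "word_value G f w \<in> carrier G"
  using assms(2) by (induction w) (use assms(1) in \<open>auto simp: word_value_def image_subset_iff\<close>)

lemma (in group) word_value_append:
  assumes "f ` S \<subseteq> carrier G" "fst ` set v \<subseteq> S" "fst ` set w \<subseteq> S"
  shows "word_value G f (v @ w) = word_value G f v \<otimes> word_value G f w"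
  using assms(2)
proof (induction v)
  case Nil
  then show ?case
    using word_value_closed[OF assms(1,3)] by (simp add: word_value_def)
next
  case (Cons a v)
  obtain x b where a: "a = (x, b)" by (cases a)
  have x: "f x \<in> carrier G" using Cons.prems a assms(1) by auto
  have v: "word_value G f v \<in> carrier G"
    using word_value_closed[OF assms(1)] Cons.prems by auto
  have step: "word_value G f (a # u) = (if b then f x else inv (f x)) \<otimes> word_value G f u" for u
    by (simp add: word_value_def a)
  have IH: "word_value G f (v @ w) = word_value G f v \<otimes> word_value G f w"
    using Cons by auto
  have c: "(if b then f x else inv (f x)) \<in> carrier G" using x by simp
  show ?case
    using m_assoc[OF c v word_value_closed[OF assms(1,3)]]
    by (simp only: append_Cons step IH)
qed

lemma (in group) generate_word_value:
  assumes "f ` S \<subseteq> carrier G" "y \<in> generate G (f ` S)"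
  shows "\<exists>w. fst ` set w \<subseteq> S \<and> word_value G f w = y"
  using assms(2)
proof (induction rule: generate.induct)
  case one
  show ?case by (rule exI[of _ "[]"]) (simp add: word_value_def)
next
  case (incl h)
  then obtain x where "x \<in> S" "h = f x" by auto
  then show ?case using assms(1)
    by (intro exI[of _ "[(x, True)]"]) (auto simp: word_value_def)
next
  case (inv h)
  then obtain x where "x \<in> S" "h = f x" by auto
  then show ?case using assms(1)
    by (intro exI[of _ "[(x, False)]"]) (auto simp: word_value_def)
next
  case (eng h1 h2)
  then obtain v w where
    "fst ` set v \<subseteq> S" "word_value G f v = h1" "fst ` set w \<subseteq> S" "word_value G f w = h2"
    by blast
  then show ?case
    using word_value_append[OF assms(1), of v w] by (intro exI[of _ "v @ w"]) auto
qed

text \<open>The universal property holds for target groups on arbitrary types.\<close>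

theorem free_topological_group_extension:
  fixes H :: "('h, 'n) monoid_scheme" and f :: "'a \<Rightarrow> 'h"
  assumes free: "free_topological_group X G T i"
    and H: "topological_group H TH" and f: "continuous_map X TH f"
  shows "\<exists>h \<in> hom G H. continuous_map T TH h \<and> (\<forall>x \<in> topspace X. h (i x) = f x)"
proof -
  interpret H: topological_group H TH by (rule H)
  define S where "S = topspace X"
  have fS: "f ` S \<subseteq> carrier H"
    using f H.topspace_eq by (auto simp: S_def continuous_map_def)
  define K where "K = generate H (f ` S)"
  have K: "subgroup K H" unfolding K_def by (rule H.generate_is_subgroup[OF fS])
  have KH: "K \<subseteq> carrier H" by (rule subgroup.subset[OF K])
  define p :: "('a \<times> bool) list \<Rightarrow> 'h" where "p = word_value H f"
  define e where "e = inv_into {w. fst ` set w \<subseteq> S} p"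
  have pe: "p (e y) = y" if "y \<in> K" for y
    using H.generate_word_value[OF fS, of y] that
    unfolding e_def K_def p_def by (intro f_inv_into_f) auto
  define C where "C = e ` K"
  have pC: "p w \<in> K" if "w \<in> C" for w using that pe by (auto simp: C_def)
  have eC: "e y \<in> C" if "y \<in> K" for y using that by (auto simp: C_def)
  have ep: "e (p w) = w" if "w \<in> C" for w using that pe by (auto simp: C_def)
  have Kone: "\<one>\<^bsub>H\<^esub> \<in> K" and Kmult: "\<And>x y. x \<in> K \<Longrightarrow> y \<in> K \<Longrightarrow> x \<otimes>\<^bsub>H\<^esub> y \<in> K"
    and Kinv: "\<And>x. x \<in> K \<Longrightarrow> inv\<^bsub>H\<^esub> x \<in> K"
    using K by (auto intro: subgroup.one_closed subgroup.m_closed subgroup.m_inv_closed)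
  define L :: "('a \<times> bool) list monoid" where
    "L = \<lparr>carrier = C, monoid.mult = (\<lambda>v w. e (p v \<otimes>\<^bsub>H\<^esub> p w)), one = e \<one>\<^bsub>H\<^esub>\<rparr>"
  define TL where "TL = pullback_topology C p TH"
  have KC: "p w \<in> carrier H" if "w \<in> C" for w using pC[OF that] KH by auto
  have L: "group L"
  proof (rule groupI)
    fix v assume v: "v \<in> carrier L"
    then have vC: "v \<in> C" by (simp add: L_def)
    show "\<exists>w\<in>carrier L. w \<otimes>\<^bsub>L\<^esub> v = \<one>\<^bsub>L\<^esub>"
      using vC KC[OF vC]
      by (intro bexI[of _ "e (inv\<^bsub>H\<^esub> (p v))"]) (auto simp: L_def pe Kinv pC eC)
  qed (use Kone Kmult Kinv KC in
      \<open>auto simp: L_def pe pC eC ep H.m_assoc subsetD[OF KH]\<close>)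
  have inv_L: "inv\<^bsub>L\<^esub> v = e (inv\<^bsub>H\<^esub> (p v))" if "v \<in> C" for v
    by (rule group.inv_equality[OF L])
      (use that KC[OF that] in \<open>auto simp: L_def pe Kinv pC eC\<close>)
  have top_L: "topspace TL = C"
    using KC by (auto simp: TL_def topspace_pullback_topology H.topspace_eq)
  have cont_p: "continuous_map TL TH p"
    using continuous_map_pullback[OF continuous_map_id, of C p TH] by (simp add: TL_def)
  have into_L: "continuous_map Z TL g"
    if "g \<in> topspace Z \<rightarrow> C" "continuous_map Z TH (p \<circ> g)" for Z :: "'z topology" and g
    unfolding TL_def by (rule continuous_map_pullback') (use that in auto)
  have "topological_group L TL"
  proof (intro topological_group.intro topological_group_axioms.intro L)
    show "topspace TL = carrier L" by (simp add: top_L L_def)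
    show "continuous_map (prod_topology TL TL) TL (\<lambda>(x, y). x \<otimes>\<^bsub>L\<^esub> y)"
    proof (rule into_L)
      show "(\<lambda>(x, y). x \<otimes>\<^bsub>L\<^esub> y) \<in> topspace (prod_topology TL TL) \<rightarrow> C"
        by (auto simp: top_L L_def intro!: eC Kmult pC)
      have "continuous_map (prod_topology TL TL) TH
              ((\<lambda>(x, y). x \<otimes>\<^bsub>H\<^esub> y) \<circ> (\<lambda>z. (p (fst z), p (snd z))))"
        by (intro continuous_map_compose[OF _ H.continuous_mult] continuous_map_pairedI
            continuous_map_compose[OF continuous_map_fst cont_p, unfolded comp_def]
            continuous_map_compose[OF continuous_map_snd cont_p, unfolded comp_def])
      then show "continuous_map (prod_topology TL TL) TH (p \<circ> (\<lambda>(x, y). x \<otimes>\<^bsub>L\<^esub> y))"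
        by (rule continuous_map_eq) (auto simp: top_L L_def pe Kmult pC)
    qed
    show "continuous_map TL TL (\<lambda>x. inv\<^bsub>L\<^esub> x)"
    proof (rule into_L)
      show "(\<lambda>x. inv\<^bsub>L\<^esub> x) \<in> topspace TL \<rightarrow> C"
        by (auto simp: top_L inv_L intro!: eC Kinv pC)
      show "continuous_map TL TH (p \<circ> (\<lambda>x. inv\<^bsub>L\<^esub> x))"
        by (rule continuous_map_eq[OF continuous_map_compose[OF cont_p H.continuous_inv]])
          (auto simp: top_L inv_L pe Kinv pC)
    qed
  qed
  moreover have fK: "f x \<in> K" if "x \<in> topspace X" for x
    using that by (auto simp: K_def S_def intro: generate.incl)
  have "continuous_map X TL (e \<circ> f)"
  proof (rule into_L)
    show "e \<circ> f \<in> topspace X \<rightarrow> C" by (auto intro!: eC fK)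
    show "continuous_map X TH (p \<circ> (e \<circ> f))"
      by (rule continuous_map_eq[OF f]) (simp add: pe fK)
  qed
  ultimately obtain h where h: "h \<in> hom G L" "continuous_map T TL h"
      "\<forall>x \<in> topspace X. h (i x) = (e \<circ> f) x"
    using free unfolding free_topological_group_def by blast
  have "p \<in> hom L H"
    by (rule homI) (auto simp: L_def KC pe Kmult pC)
  then have "p \<circ> h \<in> hom G H" using h(1) Group.hom_compose by blast
  moreover have "continuous_map T TH (p \<circ> h)" by (rule continuous_map_compose[OF h(2) cont_p])
  moreover have "\<forall>x \<in> topspace X. (p \<circ> h) (i x) = f x" using h(3) by (simp add: pe fK)
  ultimately show ?thesis by blast
qed

end

theory Submission
  imports Defs
begin

text \<open>
  Let \<open>D\<close> be the countable subgroup generated by a countable dense \<open>Q \<subseteq> X\<close>. Given entourages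
  \<open>E n g\<close> for \<open>n \<in> \<nat>\<close> and \<open>g \<in> D\<close>, let \<open>V n\<close> consist of the \<open>g u g\<inverse>\<close> with \<open>u = x\<inverse> y\<close> or
  \<open>u = x y\<inverse>\<close>, \<open>(x, y) \<in> E n g\<close>, and let \<open>W E\<close> be the set of products \<open>v\<^sub>1 \<dots> v\<^sub>k\<close> whose factors lie in
  \<open>V n\<close> for pairwise distinct \<open>n\<close> (in any order, as in Pestov's description of the topology of
  \<open>F(X)\<close>). The \<open>W E\<close> form a base at the identity of a group topology: the one delicate point is
  conjugation by \<open>z \<in> X\<close>, and there one writes \<open>z = (z q\<inverse>) q\<close> with \<open>q \<in> Q\<close> so close to \<open>z\<close> that
  \<open>z q\<inverse>\<close> and its inverse lie in \<open>V 0\<close> and \<open>V 1\<close> respectively. By freeness this topology is coarser than that of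
  \<open>F(X)\<close>, and conversely every neighbourhood of the identity contains some \<open>W E\<close>, because the
  finest uniformity refines the ones pulled back from \<open>F(X)\<close>. Only countably many entourages enter \<open>W E\<close>,
  so a base indexed by \<open>\<nat> \<Rightarrow> \<nat>\<close> of the uniformity yields one at the identity.
\<close>

section \<open>The finest compatible uniformity\<close>

lemma uniformity_on_set_composeE:
  assumes "uniformity_on_set S \<U>" "eventually E \<U>"
  obtains D where "eventually D \<U>" "\<And>x y z. D (x, y) \<Longrightarrow> D (y, z) \<Longrightarrow> E (x, z)"
proof -
  have "\<exists>D. eventually D \<U> \<and> (\<forall>x y z. D (x, y) \<longrightarrow> D (y, z) \<longrightarrow> E (x, z))"
    using assms by (simp add: uniformity_on_set_def)
  then show ?thesis using that by blast
qed

text \<open>Compatibility only describes the open sets, so that balls \<open>{y. E (x, y)}\<close>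
  are neighbourhoods needs proof: the interior of the ball is written down explicitly and shown to
  be open.\<close>

lemma compatible_uniformity_nhd:
  assumes U: "compatible_uniformity X \<U>" and E: "eventually E \<U>" and x: "x \<in> topspace X"
  obtains W where "openin X W" "x \<in> W" "\<And>y. y \<in> W \<Longrightarrow> E (x, y)"
proof
  \<comment> \<open>The points \<open>y\<close> about which some whole ball lies in the ball of
    \<open>E\<close> about \<open>x\<close>.\<close>
  define W where "W = {y \<in> topspace X. \<exists>D. eventually D \<U> \<and> (\<forall>z\<in>topspace X. D (y, z) \<longrightarrow> E (x, z))}"
  have unif: "uniformity_on_set (topspace X) \<U>"
    using U by (simp add: compatible_uniformity_def)
  have carr: "eventually (\<lambda>p. p \<in> topspace X \<times> topspace X) \<U>"
    using unif by (simp add: uniformity_on_set_def le_principal)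
  have "eventually (\<lambda>(x', z). x' = y \<longrightarrow> z \<in> W) \<U>" if y: "y \<in> W" for y
  proof -
    obtain D where D: "eventually D \<U>" "\<forall>z\<in>topspace X. D (y, z) \<longrightarrow> E (x, z)"
      using y by (auto simp: W_def)
    \<comment> \<open>A point \<open>z\<close> that is \<open>D'\<close>-close to \<open>y\<close>
      is again in \<open>W\<close>, with \<open>D'\<close> itself as witness:
      \<open>D' (z, t)\<close> gives \<open>D (y, t)\<close> and hence
      \<open>E (x, t)\<close>.\<close>
    obtain D' where D': "eventually D' \<U>" "\<And>a b c. D' (a, b) \<Longrightarrow> D' (b, c) \<Longrightarrow> D (a, c)"
      using uniformity_on_set_composeE[OF unif D(1)] by blast
    show ?thesis
      using D'(1) carr
    proof eventually_elim
      case (elim p)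
      then show ?case using D'(1,2) D(2) by (cases p) (auto simp: W_def)
    qed
  qed
  then show "openin X W"
    using U unfolding compatible_uniformity_def by (auto simp: W_def)
  show "x \<in> W" using x E by (auto simp: W_def)
  show "E (x, y)" if "y \<in> W" for y
    using that unif by (auto simp: W_def uniformity_on_set_def)
qed

text \<open>\<open>\<V>\<close> may induce a coarser topology than that of \<open>X\<close>. Then
  \<open>inf \<U> \<V>\<close>, generated by intersections of entourages, still induces the topology
  of \<open>X\<close>, so \<U> being finest gives \<open>\<U> \<le> inf \<U> \<V>\<close>.\<close>

lemma finest_compatible_uniformity_le:
  assumes U: "finest_compatible_uniformity X \<U>"
    and V: "uniformity_on_set (topspace X) \<V>"
    and nhd: "\<And>E x. eventually E \<V> \<Longrightarrow> x \<in> topspace X \<Longrightarrow>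
                \<exists>W. openin X W \<and> x \<in> W \<and> (\<forall>y\<in>W. E (x, y))"
  shows "\<U> \<le> \<V>"
proof -
  have comp: "compatible_uniformity X \<U>"
    using U by (simp add: finest_compatible_uniformity_def)
  then have unif: "uniformity_on_set (topspace X) \<U>"
    by (simp add: compatible_uniformity_def)
  have "uniformity_on_set (topspace X) (inf \<U> \<V>)"
    unfolding uniformity_on_set_def
  proof (intro conjI allI impI ballI)
    show "inf \<U> \<V> \<le> principal (topspace X \<times> topspace X)"
      using unif by (auto simp: uniformity_on_set_def intro: le_infI1)
  next
    fix E x assume "eventually E (inf \<U> \<V>)" "x \<in> topspace X"
    then show "E (x, x)"
      using unif V unfolding eventually_inf uniformity_on_set_def by blast
  next
    fix E assume "eventually E (inf \<U> \<V>)"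
    then obtain P Q where PQ: "eventually P \<U>" "eventually Q \<V>" "\<And>p. P p \<Longrightarrow> Q p \<Longrightarrow> E p"
      unfolding eventually_inf by blast
    have "eventually (\<lambda>(x, y). P (y, x)) \<U>" "eventually (\<lambda>(x, y). Q (y, x)) \<V>"
      using unif V PQ unfolding uniformity_on_set_def by blast+
    then show "eventually (\<lambda>(x, y). E (y, x)) (inf \<U> \<V>)"
      unfolding eventually_inf using PQ(3)
      by (intro exI[of _ "\<lambda>(x, y). P (y, x)"] exI[of _ "\<lambda>(x, y). Q (y, x)"]) auto
  next
    fix E assume "eventually E (inf \<U> \<V>)"
    then obtain P Q where PQ: "eventually P \<U>" "eventually Q \<V>" "\<And>p. P p \<Longrightarrow> Q p \<Longrightarrow> E p"
      unfolding eventually_inf by blast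
    obtain P' where P': "eventually P' \<U>" "\<And>x y z. P' (x, y) \<Longrightarrow> P' (y, z) \<Longrightarrow> P (x, z)"
      using uniformity_on_set_composeE[OF unif PQ(1)] by blast
    obtain Q' where Q': "eventually Q' \<V>" "\<And>x y z. Q' (x, y) \<Longrightarrow> Q' (y, z) \<Longrightarrow> Q (x, z)"
      using uniformity_on_set_composeE[OF V PQ(2)] by blast
    have "eventually (\<lambda>p. P' p \<and> Q' p) (inf \<U> \<V>)"
      unfolding eventually_inf using P'(1) Q'(1) by blast
    then show "\<exists>D. eventually D (inf \<U> \<V>) \<and>
        (\<forall>x y z. D (x, y) \<longrightarrow> D (y, z) \<longrightarrow> E (x, z))"
      using P'(2) Q'(2) PQ(3) by (intro exI[of _ "\<lambda>p. P' p \<and> Q' p"]) blast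
  qed
  \<comment> \<open>Adding entourages to \<U> keeps open sets open. Conversely, no new open sets
    appear, because balls of \<U> and of \<V> both contain open sets around their centre.\<close>
  moreover have "openin X W \<longleftrightarrow>
      W \<subseteq> topspace X \<and> (\<forall>x\<in>W. eventually (\<lambda>(x', y). x' = x \<longrightarrow> y \<in> W) (inf \<U> \<V>))" for W
  proof safe
    fix x assume "openin X W" "x \<in> W"
    then show "eventually (\<lambda>(x', y). x' = x \<longrightarrow> y \<in> W) (inf \<U> \<V>)"
      using comp unfolding compatible_uniformity_def by (blast intro: filter_leD[OF inf_le1])
  next
    fix x assume "openin X W" "x \<in> W"
    then show "x \<in> topspace X" using openin_subset by blast
  next
    assume W: "W \<subseteq> topspace X"
      "\<forall>x\<in>W. eventually (\<lambda>(x', y). x' = x \<longrightarrow> y \<in> W) (inf \<U> \<V>)"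
    show "openin X W"
    proof (subst openin_subopen, safe)
      fix x assume x: "x \<in> W"
      then obtain P Q where PQ: "eventually P \<U>" "eventually Q \<V>"
        "\<forall>p. P p \<and> Q p \<longrightarrow> (case p of (x', y) \<Rightarrow> x' = x \<longrightarrow> y \<in> W)"
        using W(2) unfolding eventually_inf by meson
      have xX: "x \<in> topspace X" using x W(1) by blast
      obtain W1 where W1: "openin X W1" "x \<in> W1" "\<And>y. y \<in> W1 \<Longrightarrow> P (x, y)"
        using compatible_uniformity_nhd[OF comp PQ(1) xX] by blast
      obtain W2 where W2: "openin X W2" "x \<in> W2" "\<forall>y\<in>W2. Q (x, y)"
        using nhd[OF PQ(2) xX] by blast
      show "\<exists>T. openin X T \<and> x \<in> T \<and> T \<subseteq> W"
        using W1 W2 PQ(3) by (intro exI[of _ "W1 \<inter> W2"]) auto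
    qed
  qed
  ultimately have "compatible_uniformity X (inf \<U> \<V>)"
    by (simp add: compatible_uniformity_def)
  then have "\<U> \<le> inf \<U> \<V>"
    using U unfolding finest_compatible_uniformity_def by blast
  then show ?thesis by simp
qed

section \<open>Topological groups\<close>

lemma (in group) mult_inv_cancel_left [simp]:
  assumes "x \<in> carrier G" "y \<in> carrier G"
  shows "x \<otimes> (inv x \<otimes> y) = y" "inv x \<otimes> (x \<otimes> y) = y"
  using assms by (simp_all flip: m_assoc)

text \<open>Open sets are those containing a left translate of a member of \<B> about each of their
  points. The explicit description in the second conclusion later yields continuity of
  \<open>i\<close>; the third has content because members of \<B> need not be open.\<close>

lemma (in group) topological_group_of_base:
  assumes ne: "\<B> \<noteq> {}"
    and sub: "\<And>B. B \<in> \<B> \<Longrightarrow> B \<subseteq> carrier G"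
    and one: "\<And>B. B \<in> \<B> \<Longrightarrow> \<one> \<in> B"
    and int: "\<And>A B. A \<in> \<B> \<Longrightarrow> B \<in> \<B> \<Longrightarrow> \<exists>C\<in>\<B>. C \<subseteq> A \<inter> B"
    and mult: "\<And>B. B \<in> \<B> \<Longrightarrow> \<exists>C\<in>\<B>. \<forall>x\<in>C. \<forall>y\<in>C. x \<otimes> y \<in> B"
    and inverse: "\<And>B. B \<in> \<B> \<Longrightarrow> \<exists>C\<in>\<B>. \<forall>x\<in>C. inv x \<in> B"
    and conj: "\<And>B g. B \<in> \<B> \<Longrightarrow> g \<in> carrier G \<Longrightarrow> \<exists>C\<in>\<B>. \<forall>x\<in>C. g \<otimes> x \<otimes> inv g \<in> B"
  obtains T where "topological_group G T"
    and "\<And>U. openin T U \<longleftrightarrow> U \<subseteq> carrier G \<and> (\<forall>x\<in>U. \<exists>B\<in>\<B>. \<forall>b\<in>B. x \<otimes> b \<in> U)"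
    and "\<And>B. B \<in> \<B> \<Longrightarrow> \<exists>U. openin T U \<and> \<one> \<in> U \<and> U \<subseteq> B"
proof -
  define opn where "opn U \<longleftrightarrow> U \<subseteq> carrier G \<and> (\<forall>x\<in>U. \<exists>B\<in>\<B>. \<forall>b\<in>B. x \<otimes> b \<in> U)" for U
  have "istopology opn"
    unfolding istopology_def
  proof (intro conjI allI impI)
    fix S R assume S: "opn S" and R: "opn R"
    have "\<exists>C\<in>\<B>. \<forall>b\<in>C. x \<otimes> b \<in> S \<inter> R" if x: "x \<in> S \<inter> R" for x
    proof -
      obtain A where "A \<in> \<B>" "\<forall>b\<in>A. x \<otimes> b \<in> S" using S x unfolding opn_def by blast
      moreover obtain B where "B \<in> \<B>" "\<forall>b\<in>B. x \<otimes> b \<in> R" using R x unfolding opn_def by blast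
      ultimately show ?thesis using int[of A B] by blast
    qed
    then show "opn (S \<inter> R)" using S R unfolding opn_def by blast
  next
    fix \<K> assume "\<forall>K\<in>\<K>. opn K"
    then show "opn (\<Union>\<K>)" unfolding opn_def by (meson Sup_le_iff UnionE UnionI)
  qed
  define T where "T = topology opn"
  have T: "openin T U \<longleftrightarrow> opn U" for U
    using \<open>istopology opn\<close> by (simp add: T_def topology_inverse')
  have "opn (carrier G)"
    unfolding opn_def using ne sub by blast
  then have top: "topspace T = carrier G"
    using T unfolding topspace_def by (auto simp: opn_def)
  have nhd: "\<exists>U. openin T U \<and> x \<in> U \<and> (\<forall>y\<in>U. inv x \<otimes> y \<in> B)"
    if x: "x \<in> carrier G" and B: "B \<in> \<B>" for x B
  proof -
    \<comment> \<open>The interior of the left translate of \<open>B\<close> by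
      \<open>x\<close>.\<close>
    define U where "U = {y \<in> carrier G. \<exists>C\<in>\<B>. \<forall>c\<in>C. inv x \<otimes> (y \<otimes> c) \<in> B}"
    have "\<exists>C\<in>\<B>. \<forall>c\<in>C. y \<otimes> c \<in> U" if y: "y \<in> U" for y
    proof -
      obtain C where C: "C \<in> \<B>" "\<forall>c\<in>C. inv x \<otimes> (y \<otimes> c) \<in> B" using y by (auto simp: U_def)
      \<comment> \<open>If \<open>y\<close> lies in \<open>U\<close> by virtue of \<open>C\<close>,
        then so does \<open>y \<otimes> c\<close> for \<open>c\<close> in \<open>C'\<close>, by
        virtue of \<open>C'\<close>.\<close>
      obtain C' where C': "C' \<in> \<B>" "\<forall>a\<in>C'. \<forall>b\<in>C'. a \<otimes> b \<in> C" using mult[OF C(1)] by blast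
      have "y \<otimes> c \<in> U" if c: "c \<in> C'" for c
        unfolding U_def
      proof (intro CollectI conjI bexI[OF _ C'(1)] ballI)
        show "y \<otimes> c \<in> carrier G" using y c C'(1) sub by (auto simp: U_def)
        show "inv x \<otimes> (y \<otimes> c \<otimes> d) \<in> B" if "d \<in> C'" for d
          using C(2) C'(2) c that y sub[OF C'(1)] by (auto simp: U_def m_assoc subset_iff)
      qed
      then show ?thesis using C'(1) by blast
    qed
    then have "openin T U" unfolding T opn_def by (auto simp: U_def)
    moreover have "x \<in> U" using x B sub[OF B] by (auto simp: U_def subset_iff intro!: bexI[of _ B])
    moreover have "\<forall>y\<in>U. inv x \<otimes> y \<in> B" using one by (fastforce simp: U_def)
    ultimately show ?thesis by blast
  qed
  have "topological_group G T"
  proof (intro topological_group.intro topological_group_axioms.intro is_group top)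
    show "continuous_map (prod_topology T T) T (\<lambda>(x, y). x \<otimes> y)"
      unfolding continuous_map_def
    proof (intro conjI allI impI)
      fix U assume "openin T U"
      then have U: "opn U" by (simp add: T)
      show "openin (prod_topology T T) {p \<in> topspace (prod_topology T T). (case p of (x, y) \<Rightarrow> x \<otimes> y) \<in> U}"
        unfolding openin_prod_topology_alt
      proof (intro allI impI)
        fix x y assume "(x, y) \<in> {p \<in> topspace (prod_topology T T). (case p of (x, y) \<Rightarrow> x \<otimes> y) \<in> U}"
        then have xy: "x \<in> carrier G" "y \<in> carrier G" "x \<otimes> y \<in> U" by (auto simp: top)
        obtain B where B: "B \<in> \<B>" "\<forall>b\<in>B. x \<otimes> y \<otimes> b \<in> U" using U xy(3) unfolding opn_def by blast
        obtain C where C: "C \<in> \<B>" "\<forall>a\<in>C. \<forall>b\<in>C. a \<otimes> b \<in> B" using mult[OF B(1)] by blast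
        obtain C' where C': "C' \<in> \<B>" "\<forall>c\<in>C'. inv y \<otimes> c \<otimes> inv (inv y) \<in> C"
          using conj[OF C(1), of "inv y"] xy by blast
        obtain M where M: "openin T M" "x \<in> M" "\<forall>a\<in>M. inv x \<otimes> a \<in> C'" using nhd[OF xy(1) C'(1)] by blast
        obtain N where N: "openin T N" "y \<in> N" "\<forall>a\<in>N. inv y \<otimes> a \<in> C" using nhd[OF xy(2) C(1)] by blast
        have "a \<otimes> b \<in> U" if "a \<in> M" "b \<in> N" for a b
        proof -
          have ab: "a \<in> carrier G" "b \<in> carrier G" using M(1) N(1) that openin_subset top by blast+
          \<comment> \<open>With \<open>a = x \<otimes> c\<close> and
            \<open>b = y \<otimes> d\<close>, moving \<open>c\<close> to the right past
            \<open>y\<close> conjugates it by \<open>inv y\<close>: \<open>a \<otimes> b\<close> is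
            \<open>x \<otimes> y\<close> times the product considered here.\<close>
          have "(inv y \<otimes> (inv x \<otimes> a) \<otimes> inv (inv y)) \<otimes> (inv y \<otimes> b) \<in> B"
            using C(2) C'(2) M(3) N(3) that by blast
          then have "x \<otimes> y \<otimes> ((inv y \<otimes> (inv x \<otimes> a) \<otimes> inv (inv y)) \<otimes> (inv y \<otimes> b)) \<in> U"
            using B(2) by blast
          then show ?thesis using xy ab by (simp add: m_assoc)
        qed
        then show "\<exists>M N. openin T M \<and> openin T N \<and> x \<in> M \<and> y \<in> N \<and>
            M \<times> N \<subseteq> {p \<in> topspace (prod_topology T T). (case p of (x, y) \<Rightarrow> x \<otimes> y) \<in> U}"
          using M(1,2) N(1,2) openin_subset[OF M(1)] openin_subset[OF N(1)]
          by (intro exI[of _ M] exI[of _ N]) auto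
      qed
    qed (auto simp: top)
    show "continuous_map T T (\<lambda>x. inv x)"
      unfolding continuous_map_def
    proof (intro conjI allI impI)
      fix U assume "openin T U"
      then have U: "opn U" by (simp add: T)
      show "openin T {x \<in> topspace T. inv x \<in> U}"
      proof (subst openin_subopen, safe)
        fix x assume x: "x \<in> topspace T" "inv x \<in> U"
        then have xc: "x \<in> carrier G" by (simp add: top)
        obtain B where B: "B \<in> \<B>" "\<forall>b\<in>B. inv x \<otimes> b \<in> U" using U x(2) unfolding opn_def by blast
        obtain C where C: "C \<in> \<B>" "\<forall>c\<in>C. x \<otimes> c \<otimes> inv x \<in> B" using conj[OF B(1) xc] by blast
        obtain C' where C': "C' \<in> \<B>" "\<forall>c\<in>C'. inv c \<in> C" using inverse[OF C(1)] by blast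
        obtain M where M: "openin T M" "x \<in> M" "\<forall>a\<in>M. inv x \<otimes> a \<in> C'" using nhd[OF xc C'(1)] by blast
        have "inv a \<in> U" if a: "a \<in> M" for a
        proof -
          have ac: "a \<in> carrier G" using M(1) a openin_subset top by blast
          \<comment> \<open>With \<open>a = x \<otimes> c\<close>, the inverse
            \<open>inv c \<otimes> inv x\<close> is rewritten as a left translate by
            \<open>inv x\<close>.\<close>
          have "inv x \<otimes> (x \<otimes> inv (inv x \<otimes> a) \<otimes> inv x) \<in> U"
            using B(2) C(2) C'(2) M(3) a by blast
          then show ?thesis using xc ac by (simp add: m_assoc inv_mult_group)
        qed
        then show "\<exists>M. openin T M \<and> x \<in> M \<and> M \<subseteq> {x \<in> topspace T. inv x \<in> U}"
          using M openin_subset by blast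
      qed
    qed (auto simp: top)
  qed
  moreover have "\<exists>U. openin T U \<and> \<one> \<in> U \<and> U \<subseteq> B" if B: "B \<in> \<B>" for B
  proof -
    obtain U where U: "openin T U" "\<one> \<in> U" "\<forall>y\<in>U. inv \<one> \<otimes> y \<in> B"
      using nhd[OF one_closed B] by blast
    have "U \<subseteq> carrier G" using U(1) openin_subset top by blast
    then have "U \<subseteq> B" using U(3) by (auto simp: subset_iff)
    then show ?thesis using U by blast
  qed
  ultimately show ?thesis using that T by (simp add: opn_def)
qed

section \<open>Neighbourhoods of the identity and pulled-back uniformities\<close>

context topological_group
begin

lemma nhd_one_mult:
  assumes "openin T N" "\<one> \<in> N"
  obtains M where "openin T M" "\<one> \<in> M" "\<And>x y. x \<in> M \<Longrightarrow> y \<in> M \<Longrightarrow> x \<otimes> y \<in> N"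
proof -
  have "openin (prod_topology T T) {p \<in> topspace (prod_topology T T). (case p of (x, y) \<Rightarrow> x \<otimes> y) \<in> N}"
    using continuous_mult assms(1) by (rule openin_continuous_map_preimage)
  moreover have "(\<one>, \<one>) \<in> {p \<in> topspace (prod_topology T T). (case p of (x, y) \<Rightarrow> x \<otimes> y) \<in> N}"
    using assms(2) by (simp add: topspace_eq)
  ultimately obtain A B where "openin T A" "openin T B" "\<one> \<in> A" "\<one> \<in> B"
    "A \<times> B \<subseteq> {p \<in> topspace (prod_topology T T). (case p of (x, y) \<Rightarrow> x \<otimes> y) \<in> N}"
    unfolding openin_prod_topology_alt by meson
  then show ?thesis by (intro that[of "A \<inter> B"]) auto
qed

lemma nhd_one_mult3:
  assumes "openin T N" "\<one> \<in> N"
  obtains M where "openin T M" "\<one> \<in> M"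
    "\<And>x y z. x \<in> M \<Longrightarrow> y \<in> M \<Longrightarrow> z \<in> M \<Longrightarrow> x \<otimes> y \<otimes> z \<in> N"
proof -
  obtain K where K: "openin T K" "\<one> \<in> K" "\<And>x y. x \<in> K \<Longrightarrow> y \<in> K \<Longrightarrow> x \<otimes> y \<in> N"
    using nhd_one_mult[OF assms] by blast
  obtain M where M: "openin T M" "\<one> \<in> M" "\<And>x y. x \<in> M \<Longrightarrow> y \<in> M \<Longrightarrow> x \<otimes> y \<in> K"
    using nhd_one_mult[OF K(1,2)] by blast
  show ?thesis
    by (rule that[of "M \<inter> K"]) (use K M in auto)
qed

text \<open>Three factors are allowed because a product will be cut into a middle factor and the two
  parts beside it.\<close>

lemma nhd_one_sequence:
  assumes "openin T N" "\<one> \<in> N"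
  obtains M where "M (0::nat) = N" "\<And>n. openin T (M n)" "\<And>n. \<one> \<in> M n"
    "\<And>n x y z. x \<in> M (Suc n) \<Longrightarrow> y \<in> M (Suc n) \<Longrightarrow> z \<in> M (Suc n) \<Longrightarrow> x \<otimes> y \<otimes> z \<in> M n"
proof -
  have "\<exists>M. \<forall>n. ((openin T (M n) \<and> \<one> \<in> M n) \<and> (n = 0 \<longrightarrow> M n = N)) \<and>
     (\<forall>x\<in>M (Suc n). \<forall>y\<in>M (Suc n). \<forall>z\<in>M (Suc n). x \<otimes> y \<otimes> z \<in> M n)"
  proof (rule dependent_nat_choice)
    show "\<exists>M. (openin T M \<and> \<one> \<in> M) \<and> (0 = (0::nat) \<longrightarrow> M = N)" using assms by blast
    show "\<exists>K. ((openin T K \<and> \<one> \<in> K) \<and> (Suc n = 0 \<longrightarrow> K = N)) \<and>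
        (\<forall>x\<in>K. \<forall>y\<in>K. \<forall>z\<in>K. x \<otimes> y \<otimes> z \<in> M)"
      if "(openin T M \<and> \<one> \<in> M) \<and> (n = 0 \<longrightarrow> M = N)" for M n
      using that nhd_one_mult3[of M] by (metis nat.distinct(1))
  qed
  then show ?thesis using that by blast
qed

text \<open>Two-sided, to cover both left translations (\<open>b = \<one>\<close>) and conjugations
  (\<open>b = inv a\<close>).\<close>

lemma continuous_map_translation:
  assumes "a \<in> carrier G" "b \<in> carrier G"
  shows "continuous_map T T (\<lambda>x. a \<otimes> x \<otimes> b)"
proof -
  have "continuous_map T T (\<lambda>x. (\<lambda>(x, y). x \<otimes> y) ((\<lambda>(x, y). x \<otimes> y) (a, x), b))"
    by (intro continuous_map_compose[OF _ continuous_mult, unfolded comp_def] continuous_map_pairedI)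
      (use assms in \<open>auto simp: topspace_eq\<close>)
  then show ?thesis by simp
qed

text \<open>The left uniformity of the group, pulled back along \<open>f\<close>, has balls that are
  neighbourhoods since \<open>f\<close> is continuous; the finest uniformity therefore refines
  it.\<close>

lemma eventually_finest_uniformity_difference:
  assumes U: "finest_compatible_uniformity X \<U>" and f: "continuous_map X T f"
    and N: "openin T N" "\<one> \<in> N"
  shows "eventually (\<lambda>(x, y). inv (f x) \<otimes> f y \<in> N) \<U>"
proof -
  have fc: "f x \<in> carrier G" if "x \<in> topspace X" for x
    using f that topspace_eq by (auto simp: continuous_map_def)
  define A where "A N = {(x, y). x \<in> topspace X \<and> y \<in> topspace X \<and> inv (f x) \<otimes> f y \<in> N}" for N
  \<comment> \<open>The pulled-back left uniformity; the sets \<open>A N\<close> form a base of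
    it.\<close>
  define \<V> where "\<V> = (INF N\<in>{N. openin T N \<and> \<one> \<in> N}. principal (A N))"
  have V: "eventually E \<V> \<longleftrightarrow> (\<exists>N. openin T N \<and> \<one> \<in> N \<and> (\<forall>p\<in>A N. E p))" for E
    unfolding \<V>_def
  proof (subst eventually_INF_base)
    show "{N. openin T N \<and> \<one> \<in> N} \<noteq> {}" using N by blast
    show "\<exists>K\<in>{N. openin T N \<and> \<one> \<in> N}. principal (A K) \<le> inf (principal (A M)) (principal (A N))"
      if "M \<in> {N. openin T N \<and> \<one> \<in> N}" "N \<in> {N. openin T N \<and> \<one> \<in> N}" for M N
      using that by (intro bexI[of _ "M \<inter> N"]) (auto simp: A_def)
  qed (auto simp: eventually_principal)
  have "uniformity_on_set (topspace X) \<V>"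
    unfolding uniformity_on_set_def
  proof (intro conjI allI impI ballI)
    show "\<V> \<le> principal (topspace X \<times> topspace X)"
      using N by (auto simp: le_principal V A_def)
  next
    fix E x assume "eventually E \<V>" "x \<in> topspace X"
    then show "E (x, x)" using fc by (fastforce simp: V A_def)
  next
    fix E assume "eventually E \<V>"
    then obtain N where N: "openin T N" "\<one> \<in> N" "\<forall>p\<in>A N. E p" by (auto simp: V)
    have "openin T {x \<in> topspace T. inv x \<in> N}"
      using continuous_inv N(1) by (rule openin_continuous_map_preimage)
    then show "eventually (\<lambda>(x, y). E (y, x)) \<V>"
      unfolding V using N fc
      by (intro exI[of _ "{x \<in> topspace T. inv x \<in> N}"])
        (auto simp: A_def topspace_eq inv_mult_group)
  next
    fix E assume "eventually E \<V>"
    then obtain N where N: "openin T N" "\<one> \<in> N" "\<forall>p\<in>A N. E p" by (auto simp: V)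
    obtain M where M: "openin T M" "\<one> \<in> M" "\<And>x y. x \<in> M \<Longrightarrow> y \<in> M \<Longrightarrow> x \<otimes> y \<in> N"
      using nhd_one_mult[OF N(1,2)] by blast
    have "(x, z) \<in> A N" if "(x, y) \<in> A M" "(y, z) \<in> A M" for x y z
      using that M(3)[of "inv (f x) \<otimes> f y" "inv (f y) \<otimes> f z"] fc by (auto simp: A_def m_assoc)
    then show "\<exists>D. eventually D \<V> \<and> (\<forall>x y z. D (x, y) \<longrightarrow> D (y, z) \<longrightarrow> E (x, z))"
      using N(3) M(1,2) by (intro exI[of _ "\<lambda>p. p \<in> A M"]) (auto simp: V)
  qed
  then have "\<U> \<le> \<V>"
  proof (rule finest_compatible_uniformity_le[OF U])
    fix E x assume E: "eventually E \<V>" and x: "x \<in> topspace X"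
    obtain N where N: "openin T N" "\<one> \<in> N" "\<forall>p\<in>A N. E p" using E by (auto simp: V)
    have "continuous_map X T (\<lambda>y. inv (f x) \<otimes> f y \<otimes> \<one>)"
      using continuous_map_compose[OF f continuous_map_translation[of "inv (f x)" \<one>]] fc[OF x]
      by (simp add: comp_def)
    then have "openin X {y \<in> topspace X. inv (f x) \<otimes> f y \<otimes> \<one> \<in> N}"
      using N(1) by (rule openin_continuous_map_preimage)
    then show "\<exists>W. openin X W \<and> x \<in> W \<and> (\<forall>y\<in>W. E (x, y))"
      using N x fc by (intro exI[of _ "{y \<in> topspace X. inv (f x) \<otimes> f y \<otimes> \<one> \<in> N}"]) (auto simp: A_def)
  qed
  moreover have "eventually (\<lambda>(x, y). inv (f x) \<otimes> f y \<in> N) \<V>"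
    using N by (auto simp: V A_def)
  ultimately show ?thesis by (rule filter_leD)
qed

end

section \<open>Products of elements with distinct indices\<close>

text \<open>The second set argument records exactly which indices occur, so that products with
  disjoint index sets can be concatenated. The order of the indices is left free, which inversion
  and conjugation below rely on.\<close>

inductive distinct_product ::
    "('g, 'm) monoid_scheme \<Rightarrow> (nat \<Rightarrow> 'g set) \<Rightarrow> nat set \<Rightarrow> 'g \<Rightarrow> bool"
  for G (structure) and V where
  one: "distinct_product G V {} \<one>"
| mult: "n \<notin> S \<Longrightarrow> v \<in> V n \<Longrightarrow> distinct_product G V S w \<Longrightarrow>
         distinct_product G V (insert n S) (v \<otimes> w)"

context group
begin

lemma distinct_product_closed:
  assumes "distinct_product G V S w" "\<And>n. V n \<subseteq> carrier G"
  shows "w \<in> carrier G"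
  using assms by (induction rule: distinct_product.induct) auto

lemma distinct_product_finite: "distinct_product G V S w \<Longrightarrow> finite S"
  by (induction rule: distinct_product.induct) auto

lemma distinct_product_singleton:
  assumes "v \<in> V n" "v \<in> carrier G"
  shows "distinct_product G V {n} v"
  using distinct_product.mult[of n "{}" v V G \<one>] assms by (simp add: distinct_product.one)

lemma distinct_product_append:
  assumes "distinct_product G V A a" "distinct_product G V B b" "A \<inter> B = {}"
    and V: "\<And>n. V n \<subseteq> carrier G"
  shows "distinct_product G V (A \<union> B) (a \<otimes> b)"
  using assms(1-3)
proof (induction rule: distinct_product.induct)
  case one
  then show ?case using distinct_product_closed[OF _ V] by auto
next
  case (mult n S v w)
  then have "distinct_product G V (insert n (S \<union> B)) (v \<otimes> (w \<otimes> b))"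
    by (intro distinct_product.mult) auto
  moreover have "v \<in> carrier G" "w \<in> carrier G" "b \<in> carrier G"
    using mult V distinct_product_closed[OF _ V] by auto
  ultimately show ?case by (simp add: m_assoc)
qed

text \<open>Injectivity keeps the indices distinct. This makes room for further factors by moving a
  product to even, odd or shifted indices.\<close>

lemma distinct_product_reindex:
  assumes "distinct_product G V S w" "inj f" "\<And>n. V n \<subseteq> V' (f n)"
  shows "distinct_product G V' (f ` S) w"
  using assms(1)
proof (induction rule: distinct_product.induct)
  case one
  show ?case by (simp add: distinct_product.one)
next
  case (mult n S v w)
  then show ?case
    using assms(2,3) unfolding image_insert
    by (intro distinct_product.mult) (auto simp: inj_image_mem_iff)
qed

text \<open>Inversion reverses the factors, which is harmless as no order of indices is
  prescribed.\<close>

lemma distinct_product_inverse: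
  assumes "distinct_product G V S w" "\<And>n. V n \<subseteq> carrier G" "\<And>n. V' n \<subseteq> carrier G"
    and "\<And>n v. v \<in> V n \<Longrightarrow> inv v \<in> V' n"
  shows "distinct_product G V' S (inv w)"
  using assms(1)
proof (induction rule: distinct_product.induct)
  case one
  show ?case by (simp add: distinct_product.one)
next
  case (mult n S v w)
  have c: "v \<in> carrier G" "w \<in> carrier G"
    using mult assms(2) distinct_product_closed[OF _ assms(2)] by auto
  have "distinct_product G V' {n} (inv v)"
    using mult(2) assms(4) c by (intro distinct_product_singleton) auto
  then have "distinct_product G V' (S \<union> {n}) (inv w \<otimes> inv v)"
    using mult assms(3) by (intro distinct_product_append) auto
  then show ?case using c by (simp add: inv_mult_group)
qed

lemma distinct_product_conj:
  assumes "distinct_product G V S w" "\<And>n. V n \<subseteq> carrier G" "g \<in> carrier G"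
    and "\<And>n v. v \<in> V n \<Longrightarrow> g \<otimes> v \<otimes> inv g \<in> V' n"
  shows "distinct_product G V' S (g \<otimes> w \<otimes> inv g)"
  using assms(1)
proof (induction rule: distinct_product.induct)
  case one
  show ?case using assms(3) by (simp add: distinct_product.one)
next
  case (mult n S v w)
  have c: "v \<in> carrier G" "w \<in> carrier G"
    using mult assms(2) distinct_product_closed[OF _ assms(2)] by auto
  have "distinct_product G V' (insert n S) ((g \<otimes> v \<otimes> inv g) \<otimes> (g \<otimes> w \<otimes> inv g))"
    using mult assms(4) by (intro distinct_product.mult) auto
  then show ?case using c assms(3) by (simp add: m_assoc)
qed

text \<open>Isolates the factor with index \<open>m\<close>; by distinctness neither remaining part
  uses \<open>m\<close> again.\<close>

lemma distinct_product_split: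
  assumes "distinct_product G V S x" "m \<in> S" and V: "\<And>n. V n \<subseteq> carrier G"
  obtains A a v B b where "distinct_product G V A a" "distinct_product G V B b" "v \<in> V m"
    "A \<subseteq> S - {m}" "B \<subseteq> S - {m}" "x = a \<otimes> v \<otimes> b"
proof -
  have "\<exists>A a v B b. distinct_product G V A a \<and> distinct_product G V B b \<and> v \<in> V m \<and>
      A \<subseteq> S - {m} \<and> B \<subseteq> S - {m} \<and> x = a \<otimes> v \<otimes> b"
    using assms(1,2)
  proof (induction rule: distinct_product.induct)
    case (mult n S u w)
    show ?case
    proof (cases "n = m")
      case True
      have "u \<in> carrier G" using mult V by auto
      then have "u \<otimes> w = \<one> \<otimes> u \<otimes> w" by simp
      then show ?thesis
        using mult True distinct_product.one[of G V] by blast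
    next
      case False
      then obtain A a v B b where *: "distinct_product G V A a" "distinct_product G V B b"
        "v \<in> V m" "A \<subseteq> S - {m}" "B \<subseteq> S - {m}" "w = a \<otimes> v \<otimes> b"
        using mult by blast
      have "a \<in> carrier G" "b \<in> carrier G"
        using distinct_product_closed[OF *(1) V] distinct_product_closed[OF *(2) V] by blast+
      moreover have "u \<in> carrier G" "v \<in> carrier G" using * mult.hyps V by blast+
      ultimately have "u \<otimes> w = (u \<otimes> a) \<otimes> v \<otimes> b" by (simp add: * m_assoc)
      moreover have "distinct_product G V (insert n A) (u \<otimes> a)"
        using * mult by (intro distinct_product.mult) auto
      moreover have "insert n A \<subseteq> insert n S - {m}" "B \<subseteq> insert n S - {m}" using * False by auto
      ultimately show ?thesis using *(2,3) by blast
    qed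
  qed auto
  then show ?thesis using that by blast
qed

text \<open>Splitting at the least index leaves two products with larger indices.\<close>

lemma distinct_product_bound:
  assumes "distinct_product G V S x" "S \<subseteq> {m..}"
    and V: "\<And>n. V n \<subseteq> N (Suc n)" and N: "\<And>n. N n \<subseteq> carrier G" "\<And>n. \<one> \<in> N n"
    and N3: "\<And>n x y z. x \<in> N (Suc n) \<Longrightarrow> y \<in> N (Suc n) \<Longrightarrow> z \<in> N (Suc n) \<Longrightarrow> x \<otimes> y \<otimes> z \<in> N n"
  shows "x \<in> N m"
proof -
  have VG: "V n \<subseteq> carrier G" for n using V N(1) by blast
  \<comment> \<open>Padding \<open>x\<close> with two factors \<one> turns the three-factor
    condition into monotonicity.\<close>
  have "N (Suc n) \<subseteq> N n" for n
  proof
    fix x assume x: "x \<in> N (Suc n)"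
    then have "x \<otimes> \<one> \<otimes> \<one> \<in> N n" using N3 N(2) by blast
    moreover have "x \<in> carrier G" using x N(1) by blast
    ultimately show "x \<in> N n" by simp
  qed
  then have anti: "N n \<subseteq> N k" if "k \<le> n" for k n
    using that by (rule lift_Suc_antimono_le)
  have "finite S" using assms(1) by (rule distinct_product_finite)
  then show ?thesis
    using assms(1,2)
  \<comment> \<open>The induction is on the index set, since the least index can sit anywhere in the
    product. The bound \<open>m\<close> varies, as the parts are bounded by
    \<open>Suc k\<close>.\<close>
  proof (induction S arbitrary: x m rule: finite_psubset_induct)
    case (psubset S)
    show ?case
    proof (cases "S = {}")
      case True
      then show ?thesis
        using psubset.prems(1) N(2) by (auto elim: distinct_product.cases)
    next
      case False
      define k where "k = Min S"
      have k: "k \<in> S" "\<And>j. j \<in> S \<Longrightarrow> k \<le> j" using False psubset.hyps by (auto simp: k_def)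
      obtain A a v B b where *: "distinct_product G V A a" "distinct_product G V B b" "v \<in> V k"
        "A \<subseteq> S - {k}" "B \<subseteq> S - {k}" "x = a \<otimes> v \<otimes> b"
        by (rule distinct_product_split[OF psubset.prems(1) k(1) VG])
      have "A \<subseteq> {Suc k..}" "B \<subseteq> {Suc k..}" "A \<subset> S" "B \<subset> S"
        using * k by (auto simp: Suc_le_eq order.strict_iff_order)
      then have "a \<in> N (Suc k)" "b \<in> N (Suc k)"
        using psubset.IH * by blast+
      then have "x \<in> N k" using N3 V *(3,6) by blast
      moreover have "m \<le> k" using psubset.prems(2) k(1) by auto
      ultimately show ?thesis using anti by blast
    qed
  qed
qed

end

section \<open>A group topology from families of entourages\<close>

locale generating_map = group G for G (structure) +
  fixes S :: "'b set" and i :: "'b \<Rightarrow> 'a" and D :: "'a set"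
  assumes i_closed: "i ` S \<subseteq> carrier G" and D_subgroup: "subgroup D G"
begin

text \<open>Both forms are included: conjugation by a generator uses
  \<open>i x \<otimes> inv (i y)\<close>, conjugation by its inverse and continuity of
  \<open>i\<close> use \<open>inv (i x) \<otimes> i y\<close>.\<close>

definition differences :: "('b \<times> 'b) set \<Rightarrow> 'a set" where
  "differences E = {u. \<exists>x\<in>S. \<exists>y\<in>S. (x, y) \<in> E \<and> (u = inv (i x) \<otimes> i y \<or> u = i x \<otimes> inv (i y))}"

text \<open>The set \<open>V n\<close> of the overview. Letting the entourage depend on
  \<open>g\<close> allows conjugation by elements of \<open>D\<close> to be absorbed by changing the
  family.\<close>

definition conj_differences :: "(nat \<Rightarrow> 'a \<Rightarrow> ('b \<times> 'b) set) \<Rightarrow> nat \<Rightarrow> 'a set" where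
  "conj_differences E n = (\<Union>g\<in>D. (\<lambda>u. g \<otimes> u \<otimes> inv g) ` differences (E n g))"

definition basic_nhd :: "(nat \<Rightarrow> 'a \<Rightarrow> ('b \<times> 'b) set) \<Rightarrow> 'a set" where
  "basic_nhd E = {w. \<exists>A. distinct_product G (conj_differences E) A w}"

lemma D_closed: "g \<in> D \<Longrightarrow> g \<in> carrier G"
  using subgroup.subset[OF D_subgroup] by blast

lemma differences_closed: "differences E \<subseteq> carrier G"
  using i_closed by (auto simp: differences_def image_subset_iff)

lemma conj_differences_closed: "conj_differences E n \<subseteq> carrier G"
  using differences_closed D_closed by (fastforce simp: conj_differences_def)

lemma conj_differencesI:
  "g \<in> D \<Longrightarrow> u \<in> differences (E n g) \<Longrightarrow> g \<otimes> u \<otimes> inv g \<in> conj_differences E n"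
  by (auto simp: conj_differences_def)

lemma conj_differences_one:
  assumes "u \<in> differences (E n \<one>)"
  shows "u \<in> conj_differences E n"
proof -
  have "\<one> \<otimes> u \<otimes> inv \<one> \<in> conj_differences E n"
    by (rule conj_differencesI) (use assms subgroup.one_closed[OF D_subgroup] in auto)
  moreover have "u \<in> carrier G" using assms differences_closed by blast
  ultimately show ?thesis by simp
qed

lemma distinct_product_conj_differences_reindex:
  assumes "distinct_product G (conj_differences E) A w" "inj f"
    and "\<And>n g. g \<in> D \<Longrightarrow> E n g \<subseteq> E' (f n) g"
  shows "distinct_product G (conj_differences E') (f ` A) w"
  using assms(1,2)
proof (rule distinct_product_reindex)
  show "conj_differences E n \<subseteq> conj_differences E' (f n)" for n
    using assms(3)[of _ n] unfolding conj_differences_def differences_def by blast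
qed

lemma basic_nhd_closed: "basic_nhd E \<subseteq> carrier G"
  using distinct_product_closed[where V = "conj_differences E"] conj_differences_closed
  by (auto simp: basic_nhd_def)

lemma one_in_basic_nhd: "\<one> \<in> basic_nhd E"
  by (auto simp: basic_nhd_def intro: distinct_product.one)

lemma differences_in_basic_nhd: "u \<in> differences (E n \<one>) \<Longrightarrow> u \<in> basic_nhd E"
  using distinct_product_singleton[of u "conj_differences E" n] conj_differences_one[of u E n]
    differences_closed[of "E n \<one>"] by (auto simp: basic_nhd_def)

lemma basic_nhd_mono:
  assumes "\<And>n g. g \<in> D \<Longrightarrow> E n g \<subseteq> E' n g"
  shows "basic_nhd E \<subseteq> basic_nhd E'"
proof
  fix w assume "w \<in> basic_nhd E"
  then obtain A where "distinct_product G (conj_differences E) A w" by (auto simp: basic_nhd_def)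
  then have "distinct_product G (conj_differences E') ((\<lambda>n. n) ` A) w"
    using assms by (intro distinct_product_conj_differences_reindex[where E = E]) auto
  then show "w \<in> basic_nhd E'" by (auto simp: basic_nhd_def)
qed

text \<open>The factors of \<open>v\<close> move to even indices and those of \<open>w\<close> to
  odd ones, so the concatenation still has distinct indices.\<close>

lemma basic_nhd_mult:
  assumes "v \<in> basic_nhd (\<lambda>n g. E (2 * n) g \<inter> E (Suc (2 * n)) g)"
    and "w \<in> basic_nhd (\<lambda>n g. E (2 * n) g \<inter> E (Suc (2 * n)) g)"
  shows "v \<otimes> w \<in> basic_nhd E"
proof -
  let ?E = "\<lambda>n g. E (2 * n) g \<inter> E (Suc (2 * n)) g"
  obtain A B where A: "distinct_product G (conj_differences ?E) A v"
    and B: "distinct_product G (conj_differences ?E) B w"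
    using assms by (auto simp: basic_nhd_def)
  have "distinct_product G (conj_differences E) ((\<lambda>n. 2 * n) ` A) v"
    by (rule distinct_product_conj_differences_reindex[OF A]) (auto simp: inj_def)
  moreover have "distinct_product G (conj_differences E) ((\<lambda>n. Suc (2 * n)) ` B) w"
    by (rule distinct_product_conj_differences_reindex[OF B]) (auto simp: inj_def)
  moreover have "(\<lambda>n. 2 * n) ` A \<inter> (\<lambda>n. Suc (2 * n)) ` B = {}"
    by (auto dest: arg_cong[of _ _ even])
  ultimately have "distinct_product G (conj_differences E) ((\<lambda>n. 2 * n) ` A \<union> (\<lambda>n. Suc (2 * n)) ` B) (v \<otimes> w)"
    using conj_differences_closed by (intro distinct_product_append) auto
  then show ?thesis by (auto simp: basic_nhd_def)
qed

lemma differences_converse: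
  assumes "u \<in> differences (E\<inverse>)"
  shows "inv u \<in> differences E"
proof -
  obtain x y where xy: "x \<in> S" "y \<in> S" "(y, x) \<in> E"
      "u = inv (i x) \<otimes> i y \<or> u = i x \<otimes> inv (i y)"
    using assms by (auto simp: differences_def)
  then have "inv u = inv (i y) \<otimes> i x \<or> inv u = i y \<otimes> inv (i x)"
    using i_closed by (auto simp: inv_mult_group image_subset_iff)
  then show ?thesis using xy by (auto simp: differences_def)
qed

text \<open>The inverse of \<open>g \<otimes> u \<otimes> inv g\<close> is the conjugate of
  \<open>inv u\<close> by the same \<open>g\<close>, and \<open>inv u\<close> is a difference over
  the converse entourage.\<close>

lemma basic_nhd_inverse:
  assumes "w \<in> basic_nhd (\<lambda>n g. (E n g)\<inverse>)"
  shows "inv w \<in> basic_nhd E"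
proof -
  obtain A where A: "distinct_product G (conj_differences (\<lambda>n g. (E n g)\<inverse>)) A w"
    using assms by (auto simp: basic_nhd_def)
  have "inv v \<in> conj_differences E n" if v: "v \<in> conj_differences (\<lambda>n g. (E n g)\<inverse>) n" for v n
  proof -
    obtain g u where gu: "g \<in> D" "u \<in> differences ((E n g)\<inverse>)" "v = g \<otimes> u \<otimes> inv g"
      using v by (auto simp: conj_differences_def)
    then have "inv v = g \<otimes> inv u \<otimes> inv g"
      using D_closed differences_closed by (auto simp: inv_mult_group m_assoc subset_iff)
    then show ?thesis using conj_differencesI gu differences_converse by metis
  qed
  then have "distinct_product G (conj_differences E) A (inv w)"
    by (rule distinct_product_inverse[OF A conj_differences_closed conj_differences_closed])
  then show ?thesis by (auto simp: basic_nhd_def)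
qed

text \<open>Conjugating a factor \<open>h \<otimes> u \<otimes> inv h\<close> by \<open>g\<close>
  replaces the conjugator \<open>h\<close> by \<open>g \<otimes> h\<close>, which stays in
  \<open>D\<close>.\<close>

lemma basic_nhd_conj_D:
  assumes "w \<in> basic_nhd (\<lambda>n h. E n (g \<otimes> h))" and g: "g \<in> D"
  shows "g \<otimes> w \<otimes> inv g \<in> basic_nhd E"
proof -
  let ?E = "\<lambda>n h. E n (g \<otimes> h)"
  obtain A where A: "distinct_product G (conj_differences ?E) A w"
    using assms by (auto simp: basic_nhd_def)
  have "g \<otimes> v \<otimes> inv g \<in> conj_differences E n" if v: "v \<in> conj_differences ?E n" for v n
  proof -
    obtain h u where hu: "h \<in> D" "u \<in> differences (E n (g \<otimes> h))" "v = h \<otimes> u \<otimes> inv h"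
      using v by (auto simp: conj_differences_def)
    then have "g \<otimes> v \<otimes> inv g = (g \<otimes> h) \<otimes> u \<otimes> inv (g \<otimes> h)"
      using g D_closed differences_closed by (auto simp: inv_mult_group m_assoc subset_iff)
    then show ?thesis
      using conj_differencesI hu subgroup.m_closed[OF D_subgroup g] by metis
  qed
  then have "distinct_product G (conj_differences E) A (g \<otimes> w \<otimes> inv g)"
    by (rule distinct_product_conj[OF A conj_differences_closed D_closed[OF g]])
  then show ?thesis by (auto simp: basic_nhd_def)
qed

text \<open>Here the factors of \<open>w\<close> are not conjugated one by one. Instead
  \<open>v\<close> and \<open>inv v\<close> become two extra factors with indices 0 and 1, freed by
  shifting the indices of \<open>w\<close> by 2.\<close>

lemma basic_nhd_conj_difference:
  assumes "w \<in> basic_nhd (\<lambda>n. E (n + 2))"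
    and v: "v \<in> differences (E 0 \<one>)" "inv v \<in> differences (E 1 \<one>)"
  shows "v \<otimes> w \<otimes> inv v \<in> basic_nhd E"
proof -
  obtain A where A: "distinct_product G (conj_differences (\<lambda>n. E (n + 2))) A w"
    using assms by (auto simp: basic_nhd_def)
  have vc: "v \<in> carrier G" using v differences_closed by blast
  have "distinct_product G (conj_differences E) ((\<lambda>n. n + 2) ` A) w"
    by (rule distinct_product_conj_differences_reindex[OF A]) (auto simp: inj_def)
  moreover have "distinct_product G (conj_differences E) {0} v" "distinct_product G (conj_differences E) {1} (inv v)"
    using v vc conj_differences_one by (auto intro!: distinct_product_singleton)
  ultimately have "distinct_product G (conj_differences E) ({0} \<union> (\<lambda>n. n + 2) ` A \<union> {1}) (v \<otimes> w \<otimes> inv v)"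
    using conj_differences_closed by (intro distinct_product_append) auto
  then show ?thesis by (auto simp: basic_nhd_def)
qed

end

section \<open>Conjugation by arbitrary elements of the generated group\<close>

definition entourage_families :: "('b \<times> 'b) filter \<Rightarrow> (nat \<Rightarrow> 'a \<Rightarrow> ('b \<times> 'b) set) set" where
  "entourage_families \<U> = {E. \<forall>n h. eventually (\<lambda>p. p \<in> E n h) \<U>}"

lemma entourage_familiesI:
  "(\<And>n h. eventually (\<lambda>p. p \<in> E n h) \<U>) \<Longrightarrow> E \<in> entourage_families \<U>"
  by (simp add: entourage_families_def)

lemma entourage_familiesD:
  "E \<in> entourage_families \<U> \<Longrightarrow> eventually (\<lambda>p. p \<in> E n h) \<U>"
  by (simp add: entourage_families_def)

text \<open>Induction along generation: a product is treated by two successive conjugations, and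
  each generator or inverse of one is a small difference times an element of
  \<open>D\<close>.\<close>

lemma (in generating_map) basic_nhd_conj:
  assumes comp: "compatible_uniformity X \<U>" and S: "S = topspace X"
    and Q: "X closure_of Q = topspace X" "Q \<subseteq> topspace X" "i ` Q \<subseteq> D"
    and gen: "g \<in> generate G (i ` S)"
    and E: "E \<in> entourage_families \<U>"
  shows "\<exists>E'\<in>entourage_families \<U>. \<forall>w\<in>basic_nhd E'. g \<otimes> w \<otimes> inv g \<in> basic_nhd E"
proof -
  have sym: "eventually (\<lambda>(x, y). P (y, x)) \<U>" if "eventually P \<U>" for P
    using comp that by (simp add: compatible_uniformity_def uniformity_on_set_def)
  \<comment> \<open>Density of \<open>Q\<close>. The two conditions serve the difference (index 0)
    and its inverse (index 1).\<close>
  have near: "\<exists>q\<in>Q. (z, q) \<in> E 0 \<one> \<and> (q, z) \<in> E 1 \<one>"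
    if z: "z \<in> S" and E: "E \<in> entourage_families \<U>" for z and E :: "nat \<Rightarrow> 'a \<Rightarrow> ('b \<times> 'b) set"
  proof -
    have "eventually (\<lambda>(x, y). (x, y) \<in> E 0 \<one> \<and> (y, x) \<in> E 1 \<one>) \<U>"
      using eventually_conj[OF entourage_familiesD[OF E, of 0 \<one>] sym[OF entourage_familiesD[OF E, of 1 \<one>]]] by (simp add: case_prod_unfold)
    then obtain W where W: "openin X W" "z \<in> W"
      "\<And>y. y \<in> W \<Longrightarrow> case (z, y) of (x, y) \<Rightarrow> (x, y) \<in> E 0 \<one> \<and> (y, x) \<in> E 1 \<one>"
      by (rule compatible_uniformity_nhd[OF comp]) (use z S in blast)+
    have "z \<in> X closure_of Q" using z Q(1) S by simp
    then obtain q where "q \<in> Q" "q \<in> W" using W(1,2) unfolding in_closure_of by blast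
    then show ?thesis using W(3)[of q] by auto
  qed
  have conj_near: "\<exists>E'\<in>entourage_families \<U>.
      \<forall>w\<in>basic_nhd E'. (v \<otimes> q) \<otimes> w \<otimes> inv (v \<otimes> q) \<in> basic_nhd E"
    if E: "E \<in> entourage_families \<U>" and q: "q \<in> D"
      and v: "v \<in> differences (E 0 \<one>)" "inv v \<in> differences (E 1 \<one>)" for E v q
  proof (intro bexI ballI)
    \<comment> \<open>The shift by 2 serves conjugation by \<open>v\<close>, the left translation by
      \<open>q\<close> conjugation by \<open>q\<close>.\<close>
    let ?E = "\<lambda>n h. E (n + 2) (q \<otimes> h)"
    show "?E \<in> entourage_families \<U>"
      by (intro entourage_familiesI entourage_familiesD[OF E])
    fix w assume w: "w \<in> basic_nhd ?E"
    have "q \<otimes> w \<otimes> inv q \<in> basic_nhd (\<lambda>n. E (n + 2))"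
      by (rule basic_nhd_conj_D[OF w q])
    then have "v \<otimes> (q \<otimes> w \<otimes> inv q) \<otimes> inv v \<in> basic_nhd E"
      using v by (rule basic_nhd_conj_difference[where E = E])
    moreover have "v \<in> carrier G" "q \<in> carrier G" "w \<in> carrier G"
      using v(1) differences_closed D_closed[OF q] w basic_nhd_closed by blast+
    ultimately show "(v \<otimes> q) \<otimes> w \<otimes> inv (v \<otimes> q) \<in> basic_nhd E"
      by (simp add: m_assoc inv_mult_group)
  qed
  show ?thesis
    using gen E
  proof (induction arbitrary: E rule: generate.induct)
    case one
    then show ?case using basic_nhd_closed by (intro bexI[of _ E]) (auto simp: subset_iff)
  next
    case (incl g)
    then obtain z where z: "z \<in> S" "g = i z" by blast
    obtain q where q: "q \<in> Q" "(z, q) \<in> E 0 \<one>" "(q, z) \<in> E 1 \<one>"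
      using near[OF z(1) incl.prems] by blast
    then have c: "i z \<in> carrier G" "i q \<in> carrier G" "q \<in> S" "i q \<in> D"
      using z i_closed Q S by auto
    \<comment> \<open>The decomposition is
      \<open>i z = (i z \<otimes> inv (i q)) \<otimes> i q\<close>.\<close>
    have "i z \<otimes> inv (i q) \<in> differences (E 0 \<one>)" "inv (i z \<otimes> inv (i q)) \<in> differences (E 1 \<one>)"
      using q z c by (auto simp: differences_def inv_mult_group)
    from conj_near[OF incl.prems c(4) this] show ?case
      using c z by (simp add: m_assoc)
  next
    case (inv g)
    then obtain z where z: "z \<in> S" "g = i z" by blast
    obtain q where q: "q \<in> Q" "(z, q) \<in> E 0 \<one>" "(q, z) \<in> E 1 \<one>"
      using near[OF z(1) inv.prems] by blast
    then have c: "i z \<in> carrier G" "i q \<in> carrier G" "q \<in> S" "i q \<in> D"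
      using z i_closed Q S by auto
    then have D: "inv (i q) \<in> D" using subgroup.m_inv_closed[OF D_subgroup] by blast
    \<comment> \<open>Dually,
      \<open>inv (i z) = (inv (i z) \<otimes> i q) \<otimes> inv (i q)\<close>, with
      \<open>inv (i q)\<close> as the element of \<open>D\<close>.\<close>
    have "inv (i z) \<otimes> i q \<in> differences (E 0 \<one>)" "inv (inv (i z) \<otimes> i q) \<in> differences (E 1 \<one>)"
      using q z c by (auto simp: differences_def inv_mult_group)
    from conj_near[OF inv.prems D this] show ?case
      using c z by (simp add: m_assoc)
  next
    case (eng g h)
    obtain E1 where E1: "E1 \<in> entourage_families \<U>"
      "\<forall>w\<in>basic_nhd E1. g \<otimes> w \<otimes> inv g \<in> basic_nhd E"
      using eng.IH(1)[OF eng.prems] by blast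
    obtain E2 where E2: "E2 \<in> entourage_families \<U>"
      "\<forall>w\<in>basic_nhd E2. h \<otimes> w \<otimes> inv h \<in> basic_nhd E1"
      using eng.IH(2)[OF E1(1)] by blast
    have "g \<in> carrier G" "h \<in> carrier G"
      using eng.hyps generate_in_carrier[OF i_closed] by blast+
    then have "(g \<otimes> h) \<otimes> w \<otimes> inv (g \<otimes> h) = g \<otimes> (h \<otimes> w \<otimes> inv h) \<otimes> inv g" if "w \<in> basic_nhd E2" for w
      using that basic_nhd_closed[of E2] by (auto simp: m_assoc inv_mult_group subset_iff)
    then show ?case using E1(2) E2 by (intro bexI[of _ E2]) simp_all
  qed
qed

section \<open>Comparison with the topology of the free topological group\<close>

text \<open>The sets \<open>basic_nhd E\<close> define a group topology \<open>T'\<close> making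
  \<open>i\<close> continuous. By freeness \<open>i\<close> extends to a continuous homomorphism
  from \<open>T\<close> to \<open>T'\<close>; it fixes the generators, so it is the identity and
  \<open>T\<close> is finer than \<open>T'\<close>.\<close>

lemma (in topological_group) basic_nhd_free_topological_group:
  assumes free: "free_topological_group X G T i" and comp: "compatible_uniformity X \<U>"
    and gm: "generating_map G (topspace X) i D"
    and Q: "X closure_of Q = topspace X" "Q \<subseteq> topspace X" "i ` Q \<subseteq> D"
    and E: "E \<in> entourage_families \<U>"
  shows "\<exists>U. openin T U \<and> \<one> \<in> U \<and> U \<subseteq> generating_map.basic_nhd G (topspace X) i D E"
proof -
  interpret generating_map G "topspace X" i D by (rule gm)
  have gen: "generate G (i ` topspace X) = carrier G"
    using free by (simp add: free_topological_group_def)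
  have unif: "uniformity_on_set (topspace X) \<U>" using comp by (simp add: compatible_uniformity_def)
  have carr: "eventually (\<lambda>p. p \<in> topspace X \<times> topspace X) \<U>"
    using unif by (simp add: uniformity_on_set_def le_principal)
  obtain T' where T': "topological_group G T'"
    "\<And>U. openin T' U \<longleftrightarrow> U \<subseteq> carrier G \<and> (\<forall>x\<in>U. \<exists>B\<in>basic_nhd ` entourage_families \<U>. \<forall>b\<in>B. x \<otimes> b \<in> U)"
    "\<And>B. B \<in> basic_nhd ` entourage_families \<U> \<Longrightarrow> \<exists>U. openin T' U \<and> \<one> \<in> U \<and> U \<subseteq> B"
  proof (rule topological_group_of_base[of "basic_nhd ` entourage_families \<U>"])
    show "basic_nhd ` entourage_families \<U> \<noteq> {}" using E by blast
    show "B \<subseteq> carrier G" "\<one> \<in> B" if "B \<in> basic_nhd ` entourage_families \<U>" for B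
      using that basic_nhd_closed one_in_basic_nhd by auto
    show "\<exists>C\<in>basic_nhd ` entourage_families \<U>. C \<subseteq> A \<inter> B" if A: "A \<in> basic_nhd ` entourage_families \<U>" and B: "B \<in> basic_nhd ` entourage_families \<U>" for A B
    proof -
      obtain E F where E: "E \<in> entourage_families \<U>" "A = basic_nhd E" and F: "F \<in> entourage_families \<U>" "B = basic_nhd F" using A B by blast
      have "(\<lambda>n h. E n h \<inter> F n h) \<in> entourage_families \<U>"
        using entourage_familiesD[OF E(1)] entourage_familiesD[OF F(1)] by (intro entourage_familiesI) (simp add: eventually_conj)
      moreover have "basic_nhd (\<lambda>n h. E n h \<inter> F n h) \<subseteq> A \<inter> B"
        unfolding E(2) F(2) by (intro Int_greatest basic_nhd_mono) auto
      ultimately show ?thesis by blast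
    qed
    show "\<exists>C\<in>basic_nhd ` entourage_families \<U>. \<forall>x\<in>C. \<forall>y\<in>C. x \<otimes> y \<in> B" if B: "B \<in> basic_nhd ` entourage_families \<U>" for B
    proof -
      obtain E where E: "E \<in> entourage_families \<U>" "B = basic_nhd E" using B by blast
      have "(\<lambda>n h. E (2 * n) h \<inter> E (Suc (2 * n)) h) \<in> entourage_families \<U>"
        using entourage_familiesD[OF E(1)] by (intro entourage_familiesI) (simp add: eventually_conj)
      then show ?thesis using basic_nhd_mult[of _ E] E(2) by blast
    qed
    show "\<exists>C\<in>basic_nhd ` entourage_families \<U>. \<forall>x\<in>C. inv x \<in> B" if B: "B \<in> basic_nhd ` entourage_families \<U>" for B
    proof -
      obtain E where E: "E \<in> entourage_families \<U>" "B = basic_nhd E" using B by blast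
      have "eventually (\<lambda>p. p \<in> (E n h)\<inverse>) \<U>" for n h
      proof -
        have "eventually (\<lambda>(x, y). (y, x) \<in> E n h) \<U>"
          using unif entourage_familiesD[OF E(1), of n h] unfolding uniformity_on_set_def by blast
        then show ?thesis by (rule eventually_mono) auto
      qed
      then have "(\<lambda>n h. (E n h)\<inverse>) \<in> entourage_families \<U>" by (rule entourage_familiesI)
      then show ?thesis using basic_nhd_inverse[of _ E] E(2) by blast
    qed
    show "\<exists>C\<in>basic_nhd ` entourage_families \<U>. \<forall>x\<in>C. g \<otimes> x \<otimes> inv g \<in> B"
      if B: "B \<in> basic_nhd ` entourage_families \<U>" and g: "g \<in> carrier G" for B g
    proof -
      obtain E where E: "E \<in> entourage_families \<U>" "B = basic_nhd E" using B by blast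
      have "g \<in> generate G (i ` topspace X)" using g gen by simp
      from basic_nhd_conj[OF comp refl Q this E(1)]
      show ?thesis unfolding E(2) by blast
    qed
  qed blast
  have "continuous_map X T' i"
    unfolding continuous_map_def
  proof (intro conjI allI impI)
    show "i \<in> topspace X \<rightarrow> topspace T'"
      using i_closed topological_group.topspace_eq[OF T'(1)] by auto
    fix U assume "openin T' U"
    have "eventually (\<lambda>(x', y). x' = x \<longrightarrow> y \<in> {x \<in> topspace X. i x \<in> U}) \<U>"
      if x: "x \<in> {x \<in> topspace X. i x \<in> U}" for x
    proof -
      obtain E where E: "E \<in> entourage_families \<U>" "\<forall>b\<in>basic_nhd E. i x \<otimes> b \<in> U"
        using \<open>openin T' U\<close> x unfolding T'(2) by blast
      show ?thesis
        using entourage_familiesD[OF E(1), of 0 \<one>] carr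
      proof eventually_elim
        case (elim p)
        obtain a y where p: "p = (a, y)" by (cases p)
        have "i y \<in> U" if "a = x"
        proof -
          \<comment> \<open>A single factor with index 0 and conjugator \<one> already leads from
            \<open>i x\<close> to \<open>i y\<close>.\<close>
          have "inv (i x) \<otimes> i y \<in> differences (E 0 \<one>)"
            using elim p that by (auto simp: differences_def)
          then have "i x \<otimes> (inv (i x) \<otimes> i y) \<in> U"
            using E(2) differences_in_basic_nhd by blast
          moreover have "i x \<in> carrier G" "i y \<in> carrier G" using elim p that i_closed by auto
          ultimately show ?thesis by simp
        qed
        then show ?case using elim p by auto
      qed
    qed
    then show "openin X {x \<in> topspace X. i x \<in> U}"
      using comp by (simp add: compatible_uniformity_def)
  qed
  \<comment> \<open>The target group is \<open>G\<close> itself under \<open>T'\<close>, on the type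
    \<open>'g\<close> and not on words, hence the universal property in its extended form.\<close>
  then obtain h where h: "h \<in> hom G G" "continuous_map T T' h" "\<forall>x\<in>topspace X. h (i x) = i x"
    using free_topological_group_extension[OF free T'(1)] by blast
  interpret h: group_hom G G h
    by (rule group_hom.intro[OF is_group is_group]) (simp add: group_hom_axioms_def h(1))
  have "h x = x" if "x \<in> generate G (i ` topspace X)" for x
    using that
  proof (induction rule: generate.induct)
    case (inv g)
    then show ?case using h(3) i_closed by auto
  next
    case (eng a b)
    then show ?case using generate_in_carrier[OF i_closed] by simp
  qed (use h(3) in auto)
  then have h_id: "h x = x" if "x \<in> carrier G" for x using that gen by simp
  obtain U where U: "openin T' U" "\<one> \<in> U" "U \<subseteq> basic_nhd E"
    using T'(3)[of "basic_nhd E"] E by blast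
  have "openin T {x \<in> topspace T. h x \<in> U}"
    using h(2) U(1) by (rule openin_continuous_map_preimage)
  then show ?thesis
    using U h_id by (intro exI[of _ "{x \<in> topspace T. h x \<in> U}"]) (auto simp: topspace_eq)
qed

text \<open>Shrink \<open>N\<close> to a sequence \<open>M\<close> and choose the entourages so that
  factors with index \<open>n\<close> lie in \<open>M (Suc n)\<close>;
  \<open>distinct_product_bound\<close> from index 0 then puts every product into
  \<open>M 0\<close>.\<close>

lemma (in topological_group) basic_nhd_subset:
  assumes gm: "generating_map G (topspace X) i D"
    and U: "finest_compatible_uniformity X \<U>" and i: "continuous_map X T i"
    and N: "openin T N" "\<one> \<in> N"
  obtains E where "\<And>n h. h \<in> D \<Longrightarrow> eventually (\<lambda>p. p \<in> E n h) \<U>"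
    "generating_map.basic_nhd G (topspace X) i D E \<subseteq> N"
proof -
  interpret generating_map G "topspace X" i D by (rule gm)
  obtain M where M: "M (0::nat) = N" "\<And>n. openin T (M n)" "\<And>n. \<one> \<in> M n"
    "\<And>n x y z. x \<in> M (Suc n) \<Longrightarrow> y \<in> M (Suc n) \<Longrightarrow> z \<in> M (Suc n) \<Longrightarrow> x \<otimes> y \<otimes> z \<in> M n"
    using nhd_one_sequence[OF N] by blast
  have MG: "M n \<subseteq> carrier G" for n using M(2) openin_subset topspace_eq by blast
  define E where "E n h = {(x, y). x \<in> topspace X \<and> y \<in> topspace X \<and>
      h \<otimes> (inv (i x) \<otimes> i y) \<otimes> inv h \<in> M (Suc n) \<and> h \<otimes> (i x \<otimes> inv (i y)) \<otimes> inv h \<in> M (Suc n)}" for n h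
  have carr: "eventually (\<lambda>p. p \<in> topspace X \<times> topspace X) \<U>"
    using U by (simp add: finest_compatible_uniformity_def compatible_uniformity_def
        uniformity_on_set_def le_principal)
  have inv_i: "continuous_map X T (\<lambda>x. inv (i x))"
    using continuous_map_compose[OF i continuous_inv] by (simp add: comp_def)
  have "eventually (\<lambda>p. p \<in> E n h) \<U>" if h: "h \<in> D" for n h
  proof -
    have hc: "h \<in> carrier G" by (rule D_closed[OF h])
    \<comment> \<open>Conjugation by the fixed \<open>h\<close> is continuous, so its effect is
      undone by passing to a preimage.\<close>
    define K where "K = {x \<in> topspace T. h \<otimes> x \<otimes> inv h \<in> M (Suc n)}"
    have "openin T K" unfolding K_def
      using continuous_map_translation[of h "inv h"] hc M(2) by (intro openin_continuous_map_preimage) auto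
    moreover have "\<one> \<in> K" using hc M(3) by (simp add: K_def topspace_eq)
    \<comment> \<open>The second kind of difference, \<open>i x \<otimes> inv (i y)\<close>, is the
      first kind for the map sending \<open>x\<close> to \<open>inv (i x)\<close>.\<close>
    ultimately have "eventually (\<lambda>(x, y). inv (i x) \<otimes> i y \<in> K) \<U>"
      "eventually (\<lambda>(x, y). inv (inv (i x)) \<otimes> inv (i y) \<in> K) \<U>"
      by (simp_all add: eventually_finest_uniformity_difference[OF U i]
          eventually_finest_uniformity_difference[OF U inv_i])
    then show ?thesis
      using carr
    proof eventually_elim
      case (elim p)
      then show ?case using i_closed by (cases p) (auto simp: E_def K_def image_subset_iff)
    qed
  qed
  moreover have "basic_nhd E \<subseteq> N"
  proof
    fix w assume "w \<in> basic_nhd E"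
    then obtain A where A: "distinct_product G (conj_differences E) A w" by (auto simp: basic_nhd_def)
    have "conj_differences E n \<subseteq> M (Suc n)" for n
      by (auto simp: conj_differences_def differences_def E_def)
    then have "w \<in> M 0"
      using distinct_product_bound[OF A, of 0 M] MG M(3,4) by blast
    then show "w \<in> N" by (simp add: M(1))
  qed
  ultimately show ?thesis using that by blast
qed

section \<open>Countability and the base indexed by Baire space\<close>

lemma (in group) countable_generate:
  assumes "countable S" "S \<subseteq> carrier G"
  shows "countable (generate G S)"
proof -
  have "generate G S \<subseteq> word_value G (\<lambda>x. x) ` lists (S \<times> UNIV)"
  proof
    fix y assume "y \<in> generate G S"
    then obtain w where w: "fst ` set w \<subseteq> S" "word_value G (\<lambda>x. x) w = y"
      using generate_word_value[of "\<lambda>x. x" S y] assms(2) by auto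
    then have "w \<in> lists (S \<times> UNIV)" by (auto simp: in_lists_conv_set)
    then show "y \<in> word_value G (\<lambda>x. x) ` lists (S \<times> UNIV)" using w(2) by blast
  qed
  moreover have "countable (lists (S \<times> (UNIV :: bool set)))" using assms(1) by simp
  ultimately show ?thesis by (metis countable_subset countable_image)
qed

theorem corollary3p11:
  fixes X :: "'a topology"
    and \<U> :: "('a \<times> 'a) filter"
    and G :: "('g, 'm) monoid_scheme"
    and T :: "'g topology"
    and i :: "'a \<Rightarrow> 'g"
  assumes "completely_regular_space X" and "Hausdorff_space X"
    and "separable_space X"
    and "finest_compatible_uniformity X \<U>"
    and "has_omega_omega_base \<U>"
    and "free_topological_group X G T i"
  shows "has_local_omega_omega_base G T"
proof -
  interpret topological_group G T
    using assms(6) by (simp add: free_topological_group_def)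
  have i: "continuous_map X T i"
  proof -
    have "homeomorphic_map X (subtopology T (i ` topspace X)) i"
      using assms(6) by (simp add: free_topological_group_def embedding_map_def)
    then show ?thesis
      by (blast dest: homeomorphic_imp_continuous_map continuous_map_into_fulltopology)
  qed
  then have iG: "i ` topspace X \<subseteq> carrier G"
    using topspace_eq by (auto simp: continuous_map_def)
  have comp: "compatible_uniformity X \<U>"
    using assms(4) by (simp add: finest_compatible_uniformity_def)
  obtain Q where Q: "countable Q" "Q \<subseteq> topspace X" "X closure_of Q = topspace X"
    using assms(3) by (auto simp: separable_space_def)
  define D where "D = generate G (i ` Q)"
  have QG: "i ` Q \<subseteq> carrier G" using iG Q(2) by blast
  have D: "countable D"
    unfolding D_def using Q(1) QG by (intro countable_generate) auto
  have QD: "i ` Q \<subseteq> D" by (auto simp: D_def intro: generate.incl)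
  interpret generating_map G "topspace X" i D
    using iG generate_is_subgroup[OF QG]
    by (intro generating_map.intro generating_map_axioms.intro is_group) (simp_all add: D_def)
  obtain F :: "(nat \<Rightarrow> nat) \<Rightarrow> ('a \<times> 'a) set"
    where F: "\<forall>\<alpha>. eventually (\<lambda>p. p \<in> F \<alpha>) \<U>"
    "\<forall>\<alpha> \<beta>. \<alpha> \<le> \<beta> \<longrightarrow> F \<beta> \<subseteq> F \<alpha>"
    "\<forall>A. eventually (\<lambda>p. p \<in> A) \<U> \<longrightarrow> (\<exists>\<alpha>. F \<alpha> \<subseteq> A)"
    using assms(5) unfolding has_omega_omega_base_def by blast
  \<comment> \<open>One \<alpha> encodes a sequence for every \<open>n\<close> and every
    \<open>g\<close> in the countable group \<open>D\<close>. Each slice only selects coordinates of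
    \<alpha>, so it is monotone in \<alpha>.\<close>
  define slice :: "(nat \<Rightarrow> nat) \<Rightarrow> nat \<Rightarrow> 'g \<Rightarrow> nat \<Rightarrow> nat" where
    "slice \<alpha> n g m = \<alpha> (prod_encode (prod_encode (n, to_nat_on D g), m))" for \<alpha> n g m
  define W where "W \<alpha> = basic_nhd (\<lambda>n g. F (slice \<alpha> n g))" for \<alpha>
  have "eventually (\<lambda>x. x \<in> W \<alpha>) (nhdsin T \<one>\<^bsub>G\<^esub>)" for \<alpha>
  proof -
    have "(\<lambda>n g. F (slice \<alpha> n g)) \<in> entourage_families \<U>"
      using F(1) by (intro entourage_familiesI) simp
    from basic_nhd_free_topological_group[OF assms(6) comp generating_map_axioms Q(3,2) QD this]
    show ?thesis unfolding eventually_nhdsin W_def by blast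
  qed
  moreover have "W \<beta> \<subseteq> W \<alpha>" if "\<alpha> \<le> \<beta>" for \<alpha> \<beta>
    unfolding W_def using that
    by (intro basic_nhd_mono F(2)[rule_format]) (auto simp: slice_def le_fun_def)
  moreover have "\<exists>\<alpha>. W \<alpha> \<subseteq> A" if A: "eventually (\<lambda>x. x \<in> A) (nhdsin T \<one>\<^bsub>G\<^esub>)" for A
  proof -
    obtain N where N: "openin T N" "\<one>\<^bsub>G\<^esub> \<in> N" "N \<subseteq> A"
      using A unfolding eventually_nhdsin topspace_eq by blast
    obtain E where E: "\<And>n h. h \<in> D \<Longrightarrow> eventually (\<lambda>p. p \<in> E n h) \<U>" "basic_nhd E \<subseteq> N"
      using basic_nhd_subset[OF generating_map_axioms assms(4) i N(1,2)] by blast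
    define \<gamma> where "\<gamma> n h = (SOME \<alpha>. F \<alpha> \<subseteq> E n h)" for n h
    have \<gamma>: "F (\<gamma> n h) \<subseteq> E n h" if "h \<in> D" for n h
      unfolding \<gamma>_def by (rule someI_ex[OF F(3)[rule_format, OF E(1)[OF that]]])
    \<comment> \<open>Inverts \<open>slice\<close>: the code \<open>l\<close> of an element of
      \<open>D\<close> is turned back by \<open>from_nat_into D\<close>, so the slices of \<alpha>
      at elements of \<open>D\<close> are the chosen \<gamma>.\<close>
    define \<alpha> where "\<alpha> k = (case prod_decode k of (p, m) \<Rightarrow>
        case prod_decode p of (n, l) \<Rightarrow> \<gamma> n (from_nat_into D l) m)" for k
    have "slice \<alpha> n h = \<gamma> n h" if "h \<in> D" for n h
      using that D by (auto simp: slice_def \<alpha>_def)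
    \<comment> \<open>Only conjugators from \<open>D\<close> enter \<open>basic_nhd\<close>, so
      agreement of the slices with \<gamma> on \<open>D\<close> suffices.\<close>
    then have "W \<alpha> \<subseteq> basic_nhd E"
      unfolding W_def using \<gamma> by (intro basic_nhd_mono) simp
    then show ?thesis using E(2) N(3) by blast
  qed
  ultimately show ?thesis
    unfolding has_local_omega_omega_base_def has_omega_omega_base_def by blast
qed

end
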